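(* For $n\ge 0$, $k\ge 1$, $r\le n+k$, $$F(n+k+r;\,n+k-r,\,n)=\sum_{t=0}^{k-2}\left[\binom{n-k+r+2}{n-t}-\binom{n-k+r+2}{n+t+3}\right]F(2k-2;\,2t+2,\,t)$$ $$\qquad+\sum_{s=0}^{k-1}\sum_{t=0}^{k-1}\binom{n-k+r+2}{s+1}\left[\binom{n-k+r+2}{n-t+1}-\binom{n-k+r+2}{n+t+2}\right]F(2k-2;\,2t,\,s+t).$$
   Context: $F(m;n_1,n_2)$ denotes the number of Gessel walks with exactly $m$ steps from $(0,0)$ to $(n_1,n_2)$: lattice walks starting at the origin, each of whose $m$ steps is one of West $(-1,0)$, North-East $(1,1)$, East $(1,0)$, South-West $(-1,-1)$, and which remain in the first quadrant $\{(i,j): i\ge 0,\ j\ge 0\}$. In particular $F(m;n_1,n_2)=0$ if $n_1<0$ or $n_2<0$, and $F(0;n_1,n_2)=1$ if $n_1=n_2=0$ and $0$ otherwise. Here $n,k,r$ are integers and $\binom{a}{b}$ denotes a binomial coefficient.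
   Formalization: Added assumption: if r ≥ 0 then n−k+r+2 ≥ 0; binomials with a negative entry are taken to be 0. Without it the formula fails, e.g. n=0, k=3, r=0: the left side is 1, the right side 0 (or 11 with generalised binomials). *)

theory Defs
  imports Main "HOL-Library.Product_Plus"
begin

definition gessel_steps :: "(int \<times> int) set" where
  "gessel_steps = {(-1, 0), (1, 1), (1, 0), (-1, -1)}"

definition quadrant :: "(int \<times> int) set" where
  "quadrant = {(i, j). 0 \<le> i \<and> 0 \<le> j}"

(* A walk is the list of its steps; its position after i steps is the sum of the
   first i of them. *)
definition gessel_walks :: "int \<Rightarrow> int \<Rightarrow> int \<Rightarrow> (int \<times> int) list set" where
  "gessel_walks m n1 n2 =
     {ws. int (length ws) = m \<and> set ws \<subseteq> gessel_steps
        \<and> (\<forall>i \<le> length ws. sum_list (take i ws) \<in> quadrant)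
        \<and> sum_list ws = (n1, n2)}"

(* The arguments are integers, so a negative number of steps or an endpoint outside
   the quadrant gives the value 0. *)
definition gessel_F :: "int \<Rightarrow> int \<Rightarrow> int \<Rightarrow> nat" where
  "gessel_F m n1 n2 = card (gessel_walks m n1 n2)"

(* Binomial coefficient with integer entries, taken to be 0 if either entry is negative.
   In the formula for gessel_F (n + k + r) (n + k - r) n the upper entry is
   N = n - k + r + 2, the number of steps left after the first 2k - 2 of the n + k + r.
   For N >= 0 the usual conventions agree. For N < 0 the formula needs a restriction:
   if r >= 0, the left-hand side is positive, but all binomials are 0 here. Reading them as
   generalised binomial coefficients does not help: for n = 0, k = 3, r = 0 the left-hand
   side is 1 and the right-hand side would be 11. If r < 0 and N < 0, both sides
   are 0 with the present definition. *)
definition ibinom :: "int \<Rightarrow> int \<Rightarrow> int" where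
  "ibinom a b = (if 0 \<le> a \<and> 0 \<le> b then int (nat a choose nat b) else 0)"

end

theory Submission
  imports Defs
begin

text \<open>Call \<open>(1, 1)\<close> and \<open>(1, 0)\<close> forward steps, and \<open>(1, 0)\<close> and \<open>(-1, -1)\<close> marked steps. The two
attributes of a step are independent. After \<open>m\<close> steps, \<open>f\<close> of them forward and \<open>c\<close> of them marked,
the walk is at \<open>(2 * f - m, f - c)\<close>. A walk to the endpoint of the theorem has \<open>c = k\<close> in total.
After \<open>2 * k - 2\<close> steps, \<open>0 \<le> 2 * f - m\<close> gives \<open>k - 1 \<le> f\<close>, and at every later time \<open>k \<le> f\<close>, so
from then on the condition \<open>c \<le> f\<close> follows from the first one. The marks of the remaining \<open>N\<close> steps
can therefore be placed freely, and the first coordinate is counted by the reflection principle.\<close>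

lemma finite_gessel_walks: "finite (gessel_walks m a b)"
proof -
  have "gessel_walks m a b \<subseteq> {ws. set ws \<subseteq> gessel_steps \<and> length ws = nat m}"
    unfolding gessel_walks_def by auto
  moreover have "finite {ws. set ws \<subseteq> gessel_steps \<and> length ws = nat m}"
    by (rule finite_lists_length_eq) (simp add: gessel_steps_def)
  ultimately show ?thesis
    by (rule finite_subset)
qed

lemma gessel_F_outside:
  assumes "a < 0 \<or> b < 0"
  shows "gessel_F m a b = 0"
proof -
  have "ws \<notin> gessel_walks m a b" for ws
  proof
    assume "ws \<in> gessel_walks m a b"
    then have "sum_list (take (length ws) ws) \<in> quadrant" "sum_list ws = (a, b)"
      unfolding gessel_walks_def by blast+
    then show False
      using assms by (simp add: quadrant_def)
  qed
  then have "gessel_walks m a b = {}"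
    by blast
  then show ?thesis
    by (simp add: gessel_F_def)
qed

lemma gessel_F_neg_length: "m < 0 \<Longrightarrow> gessel_F m a b = 0"
  by (simp add: gessel_F_def gessel_walks_def)

lemma snoc_in_gessel_walks_iff:
  "ws @ [(p, q)] \<in> gessel_walks (m + 1) a b \<longleftrightarrow>
     (p, q) \<in> gessel_steps \<and> 0 \<le> a \<and> 0 \<le> b \<and> ws \<in> gessel_walks m (a - p) (b - q)"
proof -
  have "(\<forall>i \<le> length (ws @ [(p, q)]). sum_list (take i (ws @ [(p, q)])) \<in> quadrant) \<longleftrightarrow>
      (\<forall>i \<le> length ws. sum_list (take i ws) \<in> quadrant) \<and> sum_list (ws @ [(p, q)]) \<in> quadrant"
    by (auto simp: le_Suc_eq)
  moreover have "sum_list (ws @ [(p, q)]) = (a, b) \<longleftrightarrow> sum_list ws = (a - p, b - q)"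
    by (cases "sum_list ws") auto
  ultimately show ?thesis
    unfolding gessel_walks_def by (auto simp: quadrant_def)
qed

lemma gessel_F_Suc:
  assumes "0 \<le> m" "0 \<le> a" "0 \<le> b"
  shows "gessel_F (m + 1) a b = gessel_F m (a + 1) b + gessel_F m (a - 1) (b - 1)
    + gessel_F m (a - 1) b + gessel_F m (a + 1) (b + 1)"
proof -
  define W where "W = (\<lambda>s. (\<lambda>ws. ws @ [s]) ` gessel_walks m (a - fst s) (b - snd s))"
  have "gessel_walks (m + 1) a b = (\<Union>s\<in>gessel_steps. W s)"
  proof (rule set_eqI)
    fix ws
    show "ws \<in> gessel_walks (m + 1) a b \<longleftrightarrow> ws \<in> (\<Union>s\<in>gessel_steps. W s)"
    proof (cases ws rule: rev_cases)
      case Nil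
      then show ?thesis
        using assms by (auto simp: gessel_walks_def W_def)
    next
      case (snoc us s)
      obtain p q where "s = (p, q)"
        by fastforce
      with snoc show ?thesis
        using assms by (auto simp: snoc_in_gessel_walks_iff W_def intro!: bexI[of _ "(p, q)"])
    qed
  qed
  moreover have "card (\<Union>s\<in>gessel_steps. W s) = (\<Sum>s\<in>gessel_steps. card (W s))"
    by (rule card_UN_disjoint) (auto simp: gessel_steps_def W_def finite_gessel_walks)
  moreover have "card (W s) = gessel_F m (a - fst s) (b - snd s)" for s
    unfolding W_def gessel_F_def by (rule card_image) (simp add: inj_on_def)
  ultimately have "gessel_F (m + 1) a b = (\<Sum>s\<in>gessel_steps. gessel_F m (a - fst s) (b - snd s))"
    by (simp add: gessel_F_def)
  then show ?thesis
    by (simp add: gessel_steps_def)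
qed

lemma gessel_F_0: "gessel_F 0 a b = (if a = 0 \<and> b = 0 then 1 else 0)"
proof -
  have "gessel_walks 0 a b = (if a = 0 \<and> b = 0 then {[]} else {})"
    by (auto simp: gessel_walks_def quadrant_def zero_prod_def)
  then show ?thesis
    by (simp add: gessel_F_def)
qed

text \<open>\<open>m + a\<close> is twice the number of forward steps and \<open>b\<close> is their
  excess over the marked ones. So \<open>m < a\<close> would need more than \<open>m\<close> forward
  steps, \<open>m + a < 2 * b\<close> a negative number of marks.\<close>

lemma gessel_F_unreachable:
  assumes "m < a \<or> m + a < 2 * b"
  shows "gessel_F m a b = 0"
proof (cases "0 \<le> m")
  case True
  then show ?thesis
    using assms
  proof (induction m arbitrary: a b rule: int_ge_induct)
    case base
    then show ?case
      by (auto simp: gessel_F_0)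
  next
    case (step m)
    show ?case
    proof (cases "0 \<le> a \<and> 0 \<le> b")
      case True
      have "gessel_F m (a + 1) b = 0" "gessel_F m (a - 1) (b - 1) = 0"
        "gessel_F m (a - 1) b = 0" "gessel_F m (a + 1) (b + 1) = 0"
        using step.prems by (auto intro!: step.IH)
      with True step.hyps show ?thesis
        by (simp add: gessel_F_Suc)
    next
      case False
      then show ?thesis
        by (intro gessel_F_outside) linarith
    qed
  qed
next
  case False
  then show ?thesis
    by (simp add: gessel_F_neg_length)
qed

lemma ibinom_0: "ibinom 0 i = (if i = 0 then 1 else 0)"
  by (simp add: ibinom_def)

lemma ibinom_Suc: "ibinom (int (Suc N)) i = ibinom (int N) i + ibinom (int N) (i - 1)"
proof (cases "0 < i")
  case True
  then obtain j where "i = int (Suc j)"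
    using zero_less_imp_eq_int by (metis gr0_conv_Suc)
  then show ?thesis
    by (simp add: ibinom_def nat_add_distrib)
qed (auto simp: ibinom_def)

lemma ibinom_symmetric: "ibinom (int N) i = ibinom (int N) (int N - i)"
proof (cases "0 \<le> i \<and> i \<le> int N")
  case True
  then show ?thesis
    using binomial_symmetric[of "nat i" N] by (simp add: ibinom_def nat_diff_distrib nat_le_iff)
qed (auto simp: ibinom_def)

text \<open>The pair \<open>s\<close>, \<open>t\<close> encodes the position
  \<open>(2 * t, s + t)\<close> after \<open>2 * k - 2\<close> steps, reached with
  \<open>k - 1 + t\<close> forward and \<open>k - 1 - s\<close> marked steps. Of the final totals
  \<open>f\<close> and \<open>c\<close>, the rest falls to the last \<open>N\<close> steps: the
  first binomial places the marks, the bracket places the forward steps, less the paths that meet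
  first coordinate \<open>-1\<close>. At \<open>s = -1\<close>, \<open>k\<close> marks are already
  spent.\<close>

definition continuations :: "int \<Rightarrow> nat \<Rightarrow> int \<Rightarrow> int \<Rightarrow> int" where
  "continuations k N f c = (\<Sum>s = -1..k - 1. \<Sum>t = 0..k - 1.
     ibinom (int N) (c - k + 1 + s)
     * (ibinom (int N) (f - k + 1 - t) - ibinom (int N) (f - k + 2 + t))
     * int (gessel_F (2 * k - 2) (2 * t) (s + t)))"

text \<open>Pascal's rule in both factors; the four products match the four possible last
  steps.\<close>

lemma continuations_Suc:
  "continuations k (Suc N) f c = continuations k N f c + continuations k N (f - 1) c
     + continuations k N f (c - 1) + continuations k N (f - 1) (c - 1)"
  unfolding continuations_def ibinom_Suc sum.distrib[symmetric]
  by (intro sum.cong refl) (simp add: algebra_simps)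

text \<open>The endpoint lies on the reflecting line, first coordinate \<open>-1\<close>, where the
  two binomials of each bracket are symmetric.\<close>

lemma continuations_reflection:
  assumes "2 * f = 2 * k - 3 + int N"
  shows "continuations k N f c = 0"
proof -
  have "ibinom (int N) (f - k + 1 - t) = ibinom (int N) (f - k + 2 + t)" for t
  proof -
    have "int N - (f - k + 1 - t) = f - k + 2 + t"
      using assms by linarith
    then show ?thesis
      using ibinom_symmetric[of N "f - k + 1 - t"] by metis
  qed
  then show ?thesis
    by (simp add: continuations_def)
qed

lemma continuations_0:
  assumes "k - 1 \<le> f" "c \<le> k"
  shows "continuations k 0 f c = int (gessel_F (2 * k - 2) (2 * f - (2 * k - 2)) (f - c))"
proof -
  have "continuations k 0 f c = (\<Sum>s = -1..k - 1. \<Sum>t = 0..k - 1.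
      if s = k - 1 - c then if t = f - k + 1
        then int (gessel_F (2 * k - 2) (2 * t) (s + t)) else 0 else 0)"
    \<comment> \<open>The reflected binomial vanishes, as \<open>f - k + 2 + t\<close> is at least
      1.\<close>
    unfolding continuations_def using assms by (intro sum.cong refl) (auto simp: ibinom_0)
  also have "\<dots> = (\<Sum>s = -1..k - 1. if s = k - 1 - c then
      if f - k + 1 \<in> {0..k - 1} then int (gessel_F (2 * k - 2) (2 * (f - k + 1)) (s + (f - k + 1))) else 0 else 0)"
    by (intro sum.cong refl) (simp add: sum.delta)
  also have "\<dots> = (if k - 1 - c \<in> {-1..k - 1} \<and> f - k + 1 \<in> {0..k - 1}
      then int (gessel_F (2 * k - 2) (2 * (f - k + 1)) (k - 1 - c + (f - k + 1))) else 0)"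
    by (simp add: sum.delta)
  also have "\<dots> = int (gessel_F (2 * k - 2) (2 * (f - k + 1)) (k - 1 - c + (f - k + 1)))"
    \<comment> \<open>An index beyond its range means \<open>c < 0\<close> or
      \<open>f > 2 * k - 2\<close>.\<close>
    using assms by (auto intro!: gessel_F_unreachable)
  finally show ?thesis
    by (simp add: algebra_simps)
qed

text \<open>The case \<open>2 * f = m - 1\<close>, where both sides vanish, is included so that the recurrence can be
applied at the boundary of the quadrant.\<close>

lemma gessel_F_eq_continuations:
  assumes "1 \<le> k" "m = 2 * k - 2 + int N" "m - 1 \<le> 2 * f" "c \<le> k"
  shows "int (gessel_F m (2 * f - m) (f - c)) = continuations k N f c"
  using assms(2-4)
proof (induction N arbitrary: m f c)
  case 0
  then show ?case
    using continuations_0[of k f c] by simp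
next
  case (Suc N)
  show ?case
  proof (cases "2 * f = m - 1")
    case True
    with Suc.prems show ?thesis
      by (simp add: gessel_F_outside continuations_reflection)
  next
    case False
    define l where "l = m - 1"
    have l: "l = 2 * k - 2 + int N" and f: "l + 1 \<le> 2 * f"
      using Suc.prems False by (auto simp: l_def)
    have IH: "int (gessel_F l (2 * g - l) (g - d)) = continuations k N g d"
      if "f - 1 \<le> g" "d \<le> c" for g d
      using l f that Suc.prems by (intro Suc.IH) auto
    \<comment> \<open>Here \<open>f\<close> is at least \<open>k\<close>, so the second coordinate
      \<open>f - c\<close> is nonnegative.\<close>
    have "gessel_F (l + 1) (2 * f - (l + 1)) (f - c) =
        gessel_F l (2 * f - (l + 1) + 1) (f - c) + gessel_F l (2 * f - (l + 1) - 1) (f - c - 1)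
        + gessel_F l (2 * f - (l + 1) - 1) (f - c) + gessel_F l (2 * f - (l + 1) + 1) (f - c + 1)"
      using assms(1) l f Suc.prems by (intro gessel_F_Suc) auto
    then show ?thesis
      using IH[of f c] IH[of "f - 1" c] IH[of f "c - 1"] IH[of "f - 1" "c - 1"]
      by (simp add: continuations_Suc l_def algebra_simps)
  qed
qed

theorem theorem3:
  fixes n k r :: int
  assumes "0 \<le> n" and "1 \<le> k" and "r \<le> n + k"
    and "0 \<le> r \<longrightarrow> 0 \<le> n - k + r + 2"
  shows "int (gessel_F (n + k + r) (n + k - r) n) =
      (\<Sum>t = 0..k - 2.
         (ibinom (n - k + r + 2) (n - t) - ibinom (n - k + r + 2) (n + t + 3))
         * int (gessel_F (2 * k - 2) (2 * t + 2) t))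
    + (\<Sum>s = 0..k - 1. \<Sum>t = 0..k - 1.
         ibinom (n - k + r + 2) (s + 1)
         * (ibinom (n - k + r + 2) (n - t + 1) - ibinom (n - k + r + 2) (n + t + 2))
         * int (gessel_F (2 * k - 2) (2 * t) (s + t)))"
proof (cases "0 \<le> n - k + r + 2")
  case False
  with assms(4) show ?thesis
    \<comment> \<open>Now \<open>r < 0\<close>, so the endpoint is too far to the right.\<close>
    by (simp add: ibinom_def gessel_F_unreachable)
next
  case True
  define N where "N = nat (n - k + r + 2)"
  have N: "n - k + r + 2 = int N"
    using True by (simp add: N_def)
  define T where "T = (\<lambda>s t. ibinom (int N) (s + 1)
    * (ibinom (int N) (n - t + 1) - ibinom (int N) (n + t + 2))
    * int (gessel_F (2 * k - 2) (2 * t) (s + t)))"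
  have "int (gessel_F (n + k + r) (2 * (n + k) - (n + k + r)) (n + k - k)) = continuations k N (n + k) k"
    using assms N by (intro gessel_F_eq_continuations) auto
  then have "int (gessel_F (n + k + r) (n + k - r) n) = continuations k N (n + k) k"
    by (simp add: algebra_simps)
  also have "\<dots> = (\<Sum>s = -1..k - 1. \<Sum>t = 0..k - 1. T s t)"
    by (simp add: continuations_def T_def algebra_simps)
  \<comment> \<open>The row \<open>s = -1\<close>, whose mark binomial is 1, becomes the single
    sum.\<close>
  also have "{-1..k - 1} = insert (-1) {0..k - 1}"
    using assms(2) by auto
  also have "(\<Sum>s\<in>insert (-1) {0..k - 1}. \<Sum>t = 0..k - 1. T s t) =
      (\<Sum>t = 0..k - 1. T (-1) t) + (\<Sum>s = 0..k - 1. \<Sum>t = 0..k - 1. T s t)"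
    by simp
  \<comment> \<open>In that row \<open>t = 0\<close> is the position \<open>(0, -1)\<close>, outside
    the quadrant.\<close>
  also have "{0..k - 1} = insert 0 {1..k - 1}"
    using assms(2) by auto
  also have "(\<Sum>t\<in>insert 0 {1..k - 1}. T (-1) t) = (\<Sum>t = 1..k - 1. T (-1) t)"
    by (simp add: T_def gessel_F_outside)
  also have "\<dots> = (\<Sum>t = 0..k - 2. T (-1) (t + 1))"
    by (rule sum.reindex_bij_witness[of _ "\<lambda>t. t + 1" "\<lambda>t. t - 1"]) auto
  finally show ?thesis
    unfolding N T_def \<open>{0..k - 1} = insert 0 {1..k - 1}\<close>
    by (simp add: ibinom_def algebra_simps)
qed

end
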